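(* Let $\mathrm{SM}(\hat q)=\{p(\cdot,\theta):\theta\in\Theta\}$ be a simple mixture family such that $\sup_{t\ge0}\|\mathcal L_t^\ast p(\cdot,\theta)\|_2<\infty$ for all $\theta\in\Theta$. Then the vector field (tangent) projection approximation of the Fokker-Planck-Kolmogorov equation on $\mathrm{SM}(\hat q)$ in the direct $L^2$ metric $d_D$, $$\dot\theta_t^i=\sum_{j=1}^n\gamma^{ij}\sum_{k=1}^{n+1}\hat\theta_k(\theta_t)\int\left(\mathcal L(q_j-q_{n+1})\right)(x)\,q_k(x)\,dx,\qquad \theta_0^i,\qquad i=1,\dots,n,$$ coincides with a Galerkin method $$\sum_{i=1}^{\ell}\langle\phi_i,\phi_j\rangle\,\dot c_i=\sum_{i=1}^{\ell}\langle\phi_i,\mathcal L\phi_j\rangle\,c_i,\qquad j=1,\dots,\ell,$$ where the basis functions are the mixture components, under the identification $$\ell=n+1,\qquad c_i=\theta_i\ \text{ and }\ \phi_i=q_i-q_{n+1}\ \text{ for } i=1,\dots,n,\qquad c_{n+1}=1,\ \phi_{n+1}=q_{n+1}.$$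
   Context: Consider the stochastic differential equation $dX_t=f(X_t,t)\,dt+\sigma(X_t,t)\,dW_t$ in $\mathbb R^N$, and let $a=\sigma\sigma'$ (prime denotes transpose). The Fokker-Planck-Kolmogorov (FPK) equation for the density $p_t$ of $X_t$ is $\partial_tp_t=\mathcal L_t^\ast p_t$; the FPK operator and its formal adjoint are $$\mathcal L_t^\ast p=-\sum_{i=1}^N\frac{\partial}{\partial x_i}[f_i(\cdot,t)p]+\frac12\sum_{i,j=1}^N\frac{\partial^2}{\partial x_i\partial x_j}[a_{ij}(\cdot,t)p],\qquad \mathcal L\varphi=\mathcal L_t\varphi=\sum_{i=1}^N f_i(\cdot,t)\frac{\partial\varphi}{\partial x_i}+\frac12\sum_{i,j=1}^N a_{ij}(\cdot,t)\frac{\partial^2\varphi}{\partial x_i\partial x_j}.$$ Simple mixture family: $\hat q=[q_1,\dots,q_{n+1}]'$ are $n+1$ fixed square integrable probability densities on $\mathbb R^N$, $\hat\theta(\theta)=[\theta_1,\dots,\theta_n,1-\theta_1-\dots-\theta_n]'$, and $p(\cdot,\theta)=\hat\theta(\theta)'\hat q$ for $\theta\in\Theta$, where $\Theta$ is an open subset of $\{\theta\in\mathbb R^n:\theta_i\in[0,1]\ \forall i,\ 0<\sum_{i=1}^n\theta_i<1\}$. $\langle\cdot,\cdot\rangle$ and $\|\cdot\|_2$ are the $L^2$ inner product and norm. The matrix $\gamma_{ij}=\langle q_i-q_{n+1},q_j-q_{n+1}\rangle$, $i,j=1,\dots,n$, is taken to be invertible, with inverse entries $\gamma^{ij}$. The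 displayed equation for $\theta_t$, with given initial condition $\theta_0$, is the coordinate form (after integration by parts) of $\frac{d}{dt}p(\cdot,\theta_t)=\Pi^\gamma[\mathcal L_t^\ast p(\cdot,\theta_t)]$, where $\Pi^\gamma$ is the $L^2$-orthogonal projection onto the tangent space $\mathrm{span}\{q_1-q_{n+1},\dots,q_n-q_{n+1}\}$. Galerkin method: the exact FPK solution is approximated by a linear combination of basis functions $\tilde p_t=\sum_{i=1}^\ell c_i(t)\phi_i$, and the weak form $\langle-\partial_tp_t+\mathcal L_t^\ast p_t,\xi\rangle=0$ for all smooth $L^2$ test functions $\xi$ for which the inner product exists is replaced by $\langle-\partial_t\tilde p_t+\mathcal L_t^\ast\tilde p_t,\phi_j\rangle=0$, $j=1,\dots,\ell$. By linearity of the inner product and integration by parts this gives the displayed Galerkin equations for the coefficients $c_i$.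
   Formalization: Since c_{n+1}=1 is prescribed, the Galerkin equation for j=n+1 can fail; coincidence is stated for test functions φ_1,…,φ_n (trial space all n+1 φ_i), and the full system j=1,…,n+1 is shown equivalent to the projected equation plus the equation tested against q_{n+1}. *)

theory Defs
  imports "HOL-Analysis.Analysis"
begin

section \<open>Square integrable functions\<close>

definition square_integrable :: "(real^'N \<Rightarrow> real) \<Rightarrow> bool" where
  "square_integrable g \<longleftrightarrow>
     g \<in> borel_measurable lborel \<and> integrable lborel (\<lambda>x. (g x)\<^sup>2)"

definition l2_inner :: "(real^'N \<Rightarrow> real) \<Rightarrow> (real^'N \<Rightarrow> real) \<Rightarrow> real" where
  "l2_inner g h = (LINT x|lborel. g x * h x)"

definition l2_norm :: "(real^'N \<Rightarrow> real) \<Rightarrow> real" where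
  "l2_norm g = sqrt (l2_inner g g)"

text \<open>The Bochner integral of a non-integrable function is 0, so the existence of a pairing is
  recorded separately.\<close>

definition l2_pairing_exists :: "(real^'N \<Rightarrow> real) \<Rightarrow> (real^'N \<Rightarrow> real) \<Rightarrow> bool" where
  "l2_pairing_exists g h \<longleftrightarrow> integrable lborel (\<lambda>x. g x * h x)"

section \<open>The Fokker-Planck-Kolmogorov operator and its formal adjoint\<close>

definition partial :: "'N \<Rightarrow> (real^'N \<Rightarrow> real) \<Rightarrow> real^'N \<Rightarrow> real" where
  "partial i g x = deriv (\<lambda>s. g (x + s *\<^sub>R axis i 1)) 0"

definition has_partial :: "'N \<Rightarrow> (real^'N \<Rightarrow> real) \<Rightarrow> bool" where
  "has_partial i g \<longleftrightarrow> (\<forall>x. (\<lambda>s. g (x + s *\<^sub>R axis i 1)) field_differentiable at 0)"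

text \<open>The coefficients are the drift \<open>f x t\<close> and the dispersion matrix \<open>\<sigma> x t\<close> (with \<open>N\<close> rows and
  as many columns as the Brownian motion has components).\<close>

definition diffusion :: "(real^'N \<Rightarrow> real \<Rightarrow> real^'m^'N) \<Rightarrow> real^'N \<Rightarrow> real \<Rightarrow> real^'N^'N" where
  "diffusion \<sigma> x t = \<sigma> x t ** transpose (\<sigma> x t)"

definition fpk :: "(real^'N \<Rightarrow> real \<Rightarrow> real^'N) \<Rightarrow> (real^'N \<Rightarrow> real \<Rightarrow> real^'m^'N) \<Rightarrow> real \<Rightarrow>
    (real^'N \<Rightarrow> real) \<Rightarrow> real^'N \<Rightarrow> real" where
  "fpk f \<sigma> t p x =
     - (\<Sum>i\<in>UNIV. partial i (\<lambda>y. f y t $ i * p y) x)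
     + 1/2 * (\<Sum>i\<in>UNIV. \<Sum>j\<in>UNIV. partial i (partial j (\<lambda>y. diffusion \<sigma> y t $ i $ j * p y)) x)"

definition fpk_defined :: "(real^'N \<Rightarrow> real \<Rightarrow> real^'N) \<Rightarrow> (real^'N \<Rightarrow> real \<Rightarrow> real^'m^'N) \<Rightarrow>
    real \<Rightarrow> (real^'N \<Rightarrow> real) \<Rightarrow> bool" where
  "fpk_defined f \<sigma> t p \<longleftrightarrow>
     (\<forall>i. has_partial i (\<lambda>y. f y t $ i * p y)) \<and>
     (\<forall>i j. has_partial j (\<lambda>y. diffusion \<sigma> y t $ i $ j * p y) \<and>
            has_partial i (partial j (\<lambda>y. diffusion \<sigma> y t $ i $ j * p y)))"

definition generator :: "(real^'N \<Rightarrow> real \<Rightarrow> real^'N) \<Rightarrow> (real^'N \<Rightarrow> real \<Rightarrow> real^'m^'N) \<Rightarrow> real \<Rightarrow>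
    (real^'N \<Rightarrow> real) \<Rightarrow> real^'N \<Rightarrow> real" where
  "generator f \<sigma> t \<phi> x =
     (\<Sum>i\<in>UNIV. f x t $ i * partial i \<phi> x)
     + 1/2 * (\<Sum>i\<in>UNIV. \<Sum>j\<in>UNIV. diffusion \<sigma> x t $ i $ j * partial i (partial j \<phi>) x)"

definition twice_partially_differentiable :: "(real^'N \<Rightarrow> real) \<Rightarrow> bool" where
  "twice_partially_differentiable \<phi> \<longleftrightarrow>
     (\<forall>i. has_partial i \<phi>) \<and> (\<forall>i j. has_partial i (partial j \<phi>))"

section \<open>Simple mixture families\<close>

text \<open>The \<open>n + 1\<close> components are indexed by \<open>'n option\<close>: \<open>Some i\<close> stands for the index
  \<open>i \<in> {1, \<dots>, n}\<close> and \<open>None\<close> for the index \<open>n + 1\<close>.\<close>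

definition probability_density :: "(real^'N \<Rightarrow> real) \<Rightarrow> bool" where
  "probability_density g \<longleftrightarrow> (\<forall>x. 0 \<le> g x) \<and> has_bochner_integral lborel g 1"

definition theta_hat :: "real^'n \<Rightarrow> real^('n option)" where
  "theta_hat \<theta> = (\<chi> k. case k of Some i \<Rightarrow> \<theta> $ i | None \<Rightarrow> 1 - (\<Sum>i\<in>UNIV. \<theta> $ i))"

definition mixture :: "('n option \<Rightarrow> real^'N \<Rightarrow> real) \<Rightarrow> real^'n \<Rightarrow> real^'N \<Rightarrow> real" where
  "mixture q \<theta> x = (\<Sum>k\<in>UNIV. theta_hat \<theta> $ k * q k x)"

definition tangent :: "('n option \<Rightarrow> real^'N \<Rightarrow> real) \<Rightarrow> 'n \<Rightarrow> real^'N \<Rightarrow> real" where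
  "tangent q i = (\<lambda>x. q (Some i) x - q None x)"

definition gram :: "('n option \<Rightarrow> real^'N \<Rightarrow> real) \<Rightarrow> real^'n^'n" where
  "gram q = (\<chi> i j. l2_inner (tangent q i) (tangent q j))"

definition parameter_region :: "(real^'n) set" where
  "parameter_region =
     {\<theta>. (\<forall>i. 0 \<le> \<theta> $ i \<and> \<theta> $ i \<le> 1) \<and> 0 < (\<Sum>i\<in>UNIV. \<theta> $ i) \<and> (\<Sum>i\<in>UNIV. \<theta> $ i) < 1}"

definition simple_mixture_family ::
    "('n option \<Rightarrow> real^'N \<Rightarrow> real) \<Rightarrow> (real^'n) set \<Rightarrow> bool" where
  "simple_mixture_family q \<Theta> \<longleftrightarrow>
     (\<forall>k. probability_density (q k) \<and> square_integrable (q k)) \<and>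
     openin (top_of_set parameter_region) \<Theta> \<and>
     invertible (gram q)"

definition fpk_bounded_on ::
    "(real^'N \<Rightarrow> real \<Rightarrow> real^'N) \<Rightarrow> (real^'N \<Rightarrow> real \<Rightarrow> real^'m^'N) \<Rightarrow>
     ('n option \<Rightarrow> real^'N \<Rightarrow> real) \<Rightarrow> (real^'n) set \<Rightarrow> bool" where
  "fpk_bounded_on f \<sigma> q \<Theta> \<longleftrightarrow>
     (\<forall>\<theta>\<in>\<Theta>.
        (\<forall>t\<ge>0. fpk_defined f \<sigma> t (mixture q \<theta>) \<and> square_integrable (fpk f \<sigma> t (mixture q \<theta>))) \<and>
        bdd_above ((\<lambda>t. l2_norm (fpk f \<sigma> t (mixture q \<theta>))) ` {0..}))"

section \<open>The projected equation and the Galerkin equations\<close>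

text \<open>Since solutions need not stay in \<open>\<Theta>\<close> forever, curves live on a nondegenerate time
  interval starting at 0, half-open or closed, bounded or not. At the end points the derivative
  is one-sided.\<close>

definition time_interval :: "real set \<Rightarrow> bool" where
  "time_interval T \<longleftrightarrow> is_interval T \<and> T \<subseteq> {0..} \<and> 0 \<in> T \<and> T \<noteq> {0}"

text \<open>In both systems, satisfying the equations at time \<open>t\<close> includes that the derivatives and
  integrals appearing in them exist.\<close>

definition solves_projected_fpk ::
    "(real^'N \<Rightarrow> real \<Rightarrow> real^'N) \<Rightarrow> (real^'N \<Rightarrow> real \<Rightarrow> real^'m^'N) \<Rightarrow>
     ('n option \<Rightarrow> real^'N \<Rightarrow> real) \<Rightarrow> real set \<Rightarrow> real^'n \<Rightarrow> (real \<Rightarrow> real^'n) \<Rightarrow> bool" where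
  "solves_projected_fpk f \<sigma> q T \<theta>\<^sub>0 \<theta> \<longleftrightarrow>
     \<theta> 0 = \<theta>\<^sub>0 \<and>
     (\<forall>j. twice_partially_differentiable (tangent q j)) \<and>
     (\<forall>t\<in>T.
        (\<forall>j k. l2_pairing_exists (generator f \<sigma> t (tangent q j)) (q k)) \<and>
        (\<forall>i. ((\<lambda>s. \<theta> s $ i) has_real_derivative
           (\<Sum>j\<in>UNIV. matrix_inv (gram q) $ i $ j *
              (\<Sum>k\<in>UNIV. theta_hat (\<theta> t) $ k *
                 (LINT x|lborel. generator f \<sigma> t (tangent q j) x * q k x)))) (at t within T)))"

text \<open>Galerkin equations for the basis \<open>\<phi>\<close>, tested against those \<open>\<phi> j\<close> with \<open>j \<in> J\<close>; the method
  without constraints on the coefficients has \<open>J = UNIV\<close>.\<close>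

definition solves_galerkin ::
    "(real^'N \<Rightarrow> real \<Rightarrow> real^'N) \<Rightarrow> (real^'N \<Rightarrow> real \<Rightarrow> real^'m^'N) \<Rightarrow>
     ('l::finite \<Rightarrow> real^'N \<Rightarrow> real) \<Rightarrow> 'l set \<Rightarrow> real set \<Rightarrow> real^'l \<Rightarrow> (real \<Rightarrow> real^'l) \<Rightarrow> bool" where
  "solves_galerkin f \<sigma> \<phi> J T c\<^sub>0 c \<longleftrightarrow>
     c 0 = c\<^sub>0 \<and>
     (\<forall>j\<in>J. twice_partially_differentiable (\<phi> j)) \<and>
     (\<forall>t\<in>T.
        (\<forall>j\<in>J. \<forall>i. l2_pairing_exists (\<phi> i) (\<phi> j) \<and>
                   l2_pairing_exists (\<phi> i) (generator f \<sigma> t (\<phi> j))) \<and>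
        (\<exists>c'. (\<forall>i. ((\<lambda>s. c s $ i) has_real_derivative c' i) (at t within T)) \<and>
           (\<forall>j\<in>J. (\<Sum>i\<in>UNIV. l2_inner (\<phi> i) (\<phi> j) * c' i)
                = (\<Sum>i\<in>UNIV. l2_inner (\<phi> i) (generator f \<sigma> t (\<phi> j)) * c t $ i))))"

definition galerkin_approximation ::
    "('l::finite \<Rightarrow> real^'N \<Rightarrow> real) \<Rightarrow> real^'l \<Rightarrow> real^'N \<Rightarrow> real" where
  "galerkin_approximation \<phi> c x = (\<Sum>i\<in>UNIV. c $ i * \<phi> i x)"

definition mixture_basis :: "('n option \<Rightarrow> real^'N \<Rightarrow> real) \<Rightarrow> 'n option \<Rightarrow> real^'N \<Rightarrow> real" where
  "mixture_basis q k = (case k of Some i \<Rightarrow> (\<lambda>x. q (Some i) x - q None x) | None \<Rightarrow> q None)"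

definition mixture_coeffs :: "real^'n \<Rightarrow> real^('n option)" where
  "mixture_coeffs \<theta> = (\<chi> k. case k of Some i \<Rightarrow> \<theta> $ i | None \<Rightarrow> 1)"

end

theory Submission
  imports Defs
begin

text \<open>
  In the basis \<open>q\<^sub>1 - q\<^bsub>n+1\<^esub>, \<dots>, q\<^sub>n - q\<^bsub>n+1\<^esub>, q\<^bsub>n+1\<^esub>\<close> the mixture with parameter \<open>\<theta>\<close> has the
  coefficients \<open>\<theta>\<^sub>1, \<dots>, \<theta>\<^sub>n, 1\<close>, so the Galerkin ansatz is the mixture itself. Test it against the
  tangent function \<open>q\<^sub>j - q\<^bsub>n+1\<^esub>\<close>. On the left, the last coefficient is constant and drops out; what
  remains is row \<open>j\<close> of the Gram matrix applied to the velocity of \<open>\<theta>\<close>. On the right, by linearity of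
  the inner product, stands the pairing of \<open>\<L> (q\<^sub>j - q\<^bsub>n+1\<^esub>)\<close> with the mixture, which may be expanded in
  the densities \<open>q\<^sub>k\<close> with the weights \<open>theta_hat \<theta>\<close> just as well
  (\<open>mixture_basis_pairing_sum\<close>). Multiplication by the inverse of the Gram matrix therefore turns
  these \<open>n\<close> Galerkin equations into the projected equation and back
  (\<open>projected_iff_galerkin_at\<close>).

  The family of test functions enters the Galerkin system only through one equation for each test
  function, all of them about the same velocity. A curve on a nondegenerate interval has at most one
  velocity, so the system for a union of test families is the conjunction of the two systems
  (\<open>solves_galerkin_Un\<close>). With all \<open>n + 1\<close> test functions, this adds to the projected equation exactly
  the equation tested against \<open>q\<^bsub>n+1\<^esub>\<close>.
\<close>

section \<open>Square integrable functions and their pairings\<close>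

lemma square_integrable_pairing_exists:
  assumes "square_integrable g" "square_integrable h"
  shows "l2_pairing_exists g h"
  unfolding l2_pairing_exists_def
proof (rule Bochner_Integration.integrable_bound)
  show "integrable lborel (\<lambda>x. (g x)\<^sup>2 + (h x)\<^sup>2)"
    and "(\<lambda>x. g x * h x) \<in> borel_measurable lborel"
    using assms by (auto simp: square_integrable_def)
  have "\<bar>a * b\<bar> \<le> a\<^sup>2 + b\<^sup>2" for a b :: real
  proof -
    have "2 * \<bar>a * b\<bar> \<le> a\<^sup>2 + b\<^sup>2"
      using sum_squares_bound[of "\<bar>a\<bar>" "\<bar>b\<bar>"] by (simp add: abs_mult)
    then show ?thesis by linarith
  qed
  then show "AE x in lborel. norm (g x * h x) \<le> norm ((g x)\<^sup>2 + (h x)\<^sup>2)"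
    by simp
qed

lemma square_integrable_diff:
  assumes "square_integrable g" "square_integrable h"
  shows "square_integrable (\<lambda>x. g x - h x)"
proof -
  have "integrable lborel (\<lambda>x. g x * h x)"
    using square_integrable_pairing_exists[OF assms] by (simp add: l2_pairing_exists_def)
  then have "integrable lborel (\<lambda>x. (g x)\<^sup>2 - 2 * (g x * h x) + (h x)\<^sup>2)"
    using assms by (auto simp: square_integrable_def)
  moreover have "(\<lambda>x. (g x)\<^sup>2 - 2 * (g x * h x) + (h x)\<^sup>2) = (\<lambda>x. (g x - h x)\<^sup>2)"
    by (simp add: power2_eq_square algebra_simps)
  ultimately show ?thesis
    using assms by (auto simp: square_integrable_def)
qed

lemma l2_pairing_exists_commute: "l2_pairing_exists g h \<longleftrightarrow> l2_pairing_exists h g"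
  by (simp add: l2_pairing_exists_def mult.commute)

lemma l2_inner_commute: "l2_inner g h = l2_inner h g"
  by (simp add: l2_inner_def mult.commute)

lemma l2_inner_diff_left:
  assumes "l2_pairing_exists g \<psi>" "l2_pairing_exists h \<psi>"
  shows "l2_inner (\<lambda>x. g x - h x) \<psi> = l2_inner g \<psi> - l2_inner h \<psi>"
  using assms by (simp add: l2_inner_def l2_pairing_exists_def left_diff_distrib)

section \<open>The two bases of the mixture family\<close>

lemma sum_UNIV_option:
  fixes g :: "'n::finite option \<Rightarrow> 'a::comm_monoid_add"
  shows "(\<Sum>k\<in>UNIV. g k) = g None + (\<Sum>i\<in>UNIV. g (Some i))"
  by (simp add: UNIV_option_conv sum.reindex)

lemma mixture_basis_simps [simp]:
  "mixture_basis q (Some i) = tangent q i"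
  "mixture_basis q None = q None"
  by (simp_all add: mixture_basis_def tangent_def)

lemma mixture_coeffs_nth [simp]:
  "mixture_coeffs \<theta> $ Some i = \<theta> $ i"
  "mixture_coeffs \<theta> $ None = 1"
  by (simp_all add: mixture_coeffs_def)

lemma theta_hat_nth [simp]:
  "theta_hat \<theta> $ Some i = \<theta> $ i"
  "theta_hat \<theta> $ None = 1 - (\<Sum>i\<in>UNIV. \<theta> $ i)"
  by (simp_all add: theta_hat_def)

lemma mixture_coeffs_eq_iff: "mixture_coeffs \<theta> = mixture_coeffs \<eta> \<longleftrightarrow> \<theta> = \<eta>"
  by (metis mixture_coeffs_nth(1) vec_eq_iff)

text \<open>Regrouping a combination of differences: the weights \<open>\<theta>\<close> on \<open>a\<^sub>i - a\<^bsub>n+1\<^esub>\<close> take \<open>\<Sum>\<theta>\<^sub>i\<close> away from the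
  unit weight on \<open>a\<^bsub>n+1\<^esub>\<close>. It is used once for the values of the densities and once for their
  pairings with a fixed function.\<close>

lemma theta_hat_sum:
  fixes a :: "'n::finite option \<Rightarrow> real"
  shows "(\<Sum>k\<in>UNIV. theta_hat \<theta> $ k * a k) = a None + (\<Sum>i\<in>UNIV. \<theta> $ i * (a (Some i) - a None))"
  by (simp add: sum_UNIV_option right_diff_distrib left_diff_distrib sum_subtractf sum_distrib_right)

lemma galerkin_approximation_mixture:
  "galerkin_approximation (mixture_basis q) (mixture_coeffs \<theta>) = mixture q \<theta>"
  by (rule ext)
    (simp add: galerkin_approximation_def mixture_def theta_hat_sum sum_UNIV_option tangent_def)

lemma square_integrable_mixture_basis:
  assumes "\<And>k. square_integrable (q k)"
  shows "square_integrable (mixture_basis q k)"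
  using assms by (cases k) (simp_all add: tangent_def square_integrable_diff)

text \<open>Either basis is obtained from the other by adding or subtracting \<open>q\<^bsub>n+1\<^esub>\<close>, so a function pairs
  with all members of one if and only if it pairs with all members of the other.\<close>

lemma mixture_basis_pairing_exists_iff:
  "(\<forall>k. l2_pairing_exists (mixture_basis q k) \<psi>) \<longleftrightarrow> (\<forall>k. l2_pairing_exists \<psi> (q k))"
proof
  assume basis: "\<forall>k. l2_pairing_exists (mixture_basis q k) \<psi>"
  show "\<forall>k. l2_pairing_exists \<psi> (q k)"
  proof
    fix k
    have last: "integrable lborel (\<lambda>x. q None x * \<psi> x)"
      using basis[rule_format, of None] by (simp add: l2_pairing_exists_def)
    show "l2_pairing_exists \<psi> (q k)"
    proof (cases k)
      case None
      with last show ?thesis by (simp add: l2_pairing_exists_def mult.commute)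
    next
      case (Some i)
      have "integrable lborel (\<lambda>x. tangent q i x * \<psi> x + q None x * \<psi> x)"
        using basis[rule_format, of "Some i"] last by (simp add: l2_pairing_exists_def)
      with Some show ?thesis
        by (simp add: l2_pairing_exists_def tangent_def algebra_simps)
    qed
  qed
next
  assume dens: "\<forall>k. l2_pairing_exists \<psi> (q k)"
  show "\<forall>k. l2_pairing_exists (mixture_basis q k) \<psi>"
  proof
    fix k show "l2_pairing_exists (mixture_basis q k) \<psi>"
      using dens by (cases k)
        (simp_all add: l2_pairing_exists_def tangent_def left_diff_distrib mult.commute[of "\<psi> _"])
  qed
qed

text \<open>Both sides are the pairing of \<open>\<psi>\<close> with the mixture. With \<open>\<psi> = \<L> (q\<^sub>j - q\<^bsub>n+1\<^esub>)\<close> they are the right-hand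
  sides of the Galerkin and of the projected equation.\<close>

lemma mixture_basis_pairing_sum:
  assumes "\<forall>k. l2_pairing_exists \<psi> (q k)"
  shows "(\<Sum>i\<in>UNIV. l2_inner (mixture_basis q i) \<psi> * mixture_coeffs \<theta> $ i)
       = (\<Sum>k\<in>UNIV. theta_hat \<theta> $ k * (LINT x|lborel. \<psi> x * q k x))"
proof -
  have "l2_inner (tangent q i) \<psi> = l2_inner (q (Some i)) \<psi> - l2_inner (q None) \<psi>" for i
    unfolding tangent_def using assms
    by (intro l2_inner_diff_left) (simp_all add: l2_pairing_exists_commute)
  moreover have "(LINT x|lborel. \<psi> x * q k x) = l2_inner (q k) \<psi>" for k
    by (simp add: l2_inner_def mult.commute)
  ultimately show ?thesis
    by (simp only: theta_hat_sum) (simp add: sum_UNIV_option mult.commute)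
qed

section \<open>Inverting the Gram matrix\<close>

lemma invertible_solve_iff:
  fixes A :: "real^'n^'n"
  assumes "invertible A"
  shows "A *v x = b \<longleftrightarrow> x = matrix_inv A *v b"
proof -
  have "A ** matrix_inv A = mat 1 \<and> matrix_inv A ** A = mat 1"
    using assms unfolding invertible_def matrix_inv_def by (rule someI_ex)
  then show ?thesis
    by (metis matrix_vector_mul_assoc matrix_vector_mul_lid)
qed

lemma gram_mult_nth:
  "(gram q *v v) $ j = (\<Sum>i\<in>UNIV. l2_inner (tangent q i) (tangent q j) * v $ i)"
  by (simp add: gram_def matrix_vector_mult_def l2_inner_commute)

section \<open>Uniqueness of velocities\<close>

text \<open>A nondegenerate interval accumulates at each of its points, so even the one-sided derivatives at
  its end points are unique.\<close>

lemma time_interval_derivative_unique: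
  fixes g :: "real \<Rightarrow> real"
  assumes T: "time_interval T" and t: "t \<in> T"
    and "(g has_real_derivative a) (at t within T)" "(g has_real_derivative b) (at t within T)"
  shows "a = b"
proof -
  have "T \<noteq> {x}" for x
    using T by (auto simp: time_interval_def)
  then have "t islimpt T"
    using T t by (auto simp: time_interval_def is_interval_connected intro!: connected_imp_perfect)
  then have "at t within T \<noteq> bot"
    by (simp add: trivial_limit_within)
  then show ?thesis
    using assms(3,4) has_field_derivative_unique by blast
qed

text \<open>The velocity is existentially quantified in each Galerkin system; its uniqueness is what lets
  the equations of the two systems be about one and the same velocity.\<close>

lemma solves_galerkin_Un:
  assumes "time_interval T"
  shows "solves_galerkin f \<sigma> \<phi> (J \<union> K) T c\<^sub>0 c \<longleftrightarrow>
     solves_galerkin f \<sigma> \<phi> J T c\<^sub>0 c \<and> solves_galerkin f \<sigma> \<phi> K T c\<^sub>0 c"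
    (is "?JK \<longleftrightarrow> ?J \<and> ?K")
proof
  show "?J \<and> ?K" if ?JK
    using that unfolding solves_galerkin_def ball_Un by blast
next
  assume "?J \<and> ?K"
  then have J: ?J and K: ?K by auto
  have "\<exists>c'. (\<forall>i. ((\<lambda>s. c s $ i) has_real_derivative c' i) (at t within T)) \<and>
      (\<forall>j\<in>J \<union> K. (\<Sum>i\<in>UNIV. l2_inner (\<phi> i) (\<phi> j) * c' i)
          = (\<Sum>i\<in>UNIV. l2_inner (\<phi> i) (generator f \<sigma> t (\<phi> j)) * c t $ i))" if t: "t \<in> T" for t
  proof -
    obtain c' where c': "\<And>i. ((\<lambda>s. c s $ i) has_real_derivative c' i) (at t within T)"
      and eqJ: "\<forall>j\<in>J. (\<Sum>i\<in>UNIV. l2_inner (\<phi> i) (\<phi> j) * c' i)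
          = (\<Sum>i\<in>UNIV. l2_inner (\<phi> i) (generator f \<sigma> t (\<phi> j)) * c t $ i)"
      using J t unfolding solves_galerkin_def by blast
    obtain d' where d': "\<And>i. ((\<lambda>s. c s $ i) has_real_derivative d' i) (at t within T)"
      and eqK: "\<forall>j\<in>K. (\<Sum>i\<in>UNIV. l2_inner (\<phi> i) (\<phi> j) * d' i)
          = (\<Sum>i\<in>UNIV. l2_inner (\<phi> i) (generator f \<sigma> t (\<phi> j)) * c t $ i)"
      using K t unfolding solves_galerkin_def by blast
    have "d' = c'"
      using time_interval_derivative_unique[OF assms t d' c'] by auto
    with c' eqJ eqK show ?thesis by blast
  qed
  then show ?JK
    using J K unfolding solves_galerkin_def by auto
qed

section \<open>The projected equation as a Galerkin system\<close>

text \<open>The equivalence at one instant. The Galerkin velocity has \<open>n + 1\<close> entries, but its last entry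
  is the derivative of the constant coefficient \<open>1\<close> and hence vanishes; this removes the products
  \<open>\<langle>q\<^bsub>n+1\<^esub>, q\<^sub>j - q\<^bsub>n+1\<^esub>\<rangle>\<close> and leaves the linear system of the Gram matrix.\<close>

lemma projected_iff_galerkin_at:
  fixes q :: "'n::finite option \<Rightarrow> real^'N \<Rightarrow> real"
  assumes "invertible (gram q)" and T: "time_interval T" "t \<in> T"
    and pair: "\<forall>j k. l2_pairing_exists (generator f \<sigma> t (tangent q j)) (q k)"
  shows "(\<forall>i. ((\<lambda>s. \<theta> s $ i) has_real_derivative
            (\<Sum>j\<in>UNIV. matrix_inv (gram q) $ i $ j *
              (\<Sum>k\<in>UNIV. theta_hat (\<theta> t) $ k *
                 (LINT x|lborel. generator f \<sigma> t (tangent q j) x * q k x)))) (at t within T))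
    \<longleftrightarrow> (\<exists>c'. (\<forall>i. ((\<lambda>s. mixture_coeffs (\<theta> s) $ i) has_real_derivative c' i) (at t within T)) \<and>
          (\<forall>j\<in>range Some. (\<Sum>i\<in>UNIV. l2_inner (mixture_basis q i) (mixture_basis q j) * c' i)
             = (\<Sum>i\<in>UNIV. l2_inner (mixture_basis q i) (generator f \<sigma> t (mixture_basis q j))
                   * mixture_coeffs (\<theta> t) $ i)))"
    (is "?projected \<longleftrightarrow> (\<exists>c'. ?velocity c' \<and> ?tested c')")
proof -
  define b :: "real^'n" where "b = (\<chi> j. \<Sum>k\<in>UNIV. theta_hat (\<theta> t) $ k *
      (LINT x|lborel. generator f \<sigma> t (tangent q j) x * q k x))"
  have projected: "?projected \<longleftrightarrow>
      (\<forall>i. ((\<lambda>s. \<theta> s $ i) has_real_derivative (matrix_inv (gram q) *v b) $ i) (at t within T))"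
    by (simp add: b_def matrix_vector_mult_def)
  have tested: "?tested c' \<longleftrightarrow> (\<chi> i. c' (Some i)) = matrix_inv (gram q) *v b"
    if "c' None = 0" for c'
  proof -
    have "?tested c' \<longleftrightarrow> gram q *v (\<chi> i. c' (Some i)) = b"
      using that pair
      by (simp add: vec_eq_iff gram_mult_nth b_def sum_UNIV_option[where g="\<lambda>i. _ i * c' i"]
            mixture_basis_pairing_sum)
    then show ?thesis
      by (simp add: invertible_solve_iff[OF assms(1)])
  qed
  show ?thesis
  proof
    assume proj: ?projected
    define c' where "c' k = (case k of Some i \<Rightarrow> (matrix_inv (gram q) *v b) $ i | None \<Rightarrow> 0)" for k
    have "?velocity c'"
    proof
      fix k show "((\<lambda>s. mixture_coeffs (\<theta> s) $ k) has_real_derivative c' k) (at t within T)"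
        using proj[unfolded projected] by (cases k) (simp_all add: c'_def)
    qed
    moreover have "?tested c'"
      by (subst tested) (simp_all add: c'_def vec_eq_iff)
    ultimately show "\<exists>c'. ?velocity c' \<and> ?tested c'" by blast
  next
    assume "\<exists>c'. ?velocity c' \<and> ?tested c'"
    then obtain c' where velocity: "?velocity c'" and eqs: "?tested c'" by blast
    have "((\<lambda>s. 1) has_real_derivative c' None) (at t within T)"
      using velocity[rule_format, of None] by simp
    then have "c' None = 0"
      using time_interval_derivative_unique[OF T] DERIV_const by blast
    then have "(\<chi> i. c' (Some i)) = matrix_inv (gram q) *v b"
      using eqs tested by simp
    then have "c' (Some i) = (matrix_inv (gram q) *v b) $ i" for i
      by (metis vec_lambda_beta)
    then show ?projected
      unfolding projected using velocity by (metis (no_types, lifting) ext mixture_coeffs_nth(1))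
  qed
qed

lemma solves_projected_iff_galerkin_tangent:
  assumes q: "\<And>k. square_integrable (q k)" and gram: "invertible (gram q)" and T: "time_interval T"
  shows "solves_projected_fpk f \<sigma> q T \<theta>\<^sub>0 \<theta> \<longleftrightarrow>
     solves_galerkin f \<sigma> (mixture_basis q) (range Some) T
       (mixture_coeffs \<theta>\<^sub>0) (\<lambda>t. mixture_coeffs (\<theta> t))"
proof -
  have basis: "l2_pairing_exists (mixture_basis q i) (mixture_basis q j)" for i j
    by (intro square_integrable_pairing_exists square_integrable_mixture_basis q)
  have pair: "(\<forall>j\<in>range Some. \<forall>i. l2_pairing_exists (mixture_basis q i) (mixture_basis q j) \<and>
        l2_pairing_exists (mixture_basis q i) (generator f \<sigma> t (mixture_basis q j)))
      \<longleftrightarrow> (\<forall>j k. l2_pairing_exists (generator f \<sigma> t (tangent q j)) (q k))" for t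
    using mixture_basis_pairing_exists_iff basis by force
  have diff: "(\<forall>j\<in>range Some. twice_partially_differentiable (mixture_basis q j))
      \<longleftrightarrow> (\<forall>j. twice_partially_differentiable (tangent q j))"
    by simp
  show ?thesis
    unfolding solves_projected_fpk_def solves_galerkin_def pair diff mixture_coeffs_eq_iff
    using projected_iff_galerkin_at[OF gram T] by blast
qed

theorem theorem4p7:
  fixes f :: "real^'N \<Rightarrow> real \<Rightarrow> real^'N"
    and \<sigma> :: "real^'N \<Rightarrow> real \<Rightarrow> real^'m^'N"
    and q :: "'n::finite option \<Rightarrow> real^'N \<Rightarrow> real"
    and \<Theta> :: "(real^'n) set"
    and T :: "real set"
    and \<theta>\<^sub>0 :: "real^'n"
    and \<theta> :: "real \<Rightarrow> real^'n"
  assumes "simple_mixture_family q \<Theta>"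
    and "fpk_bounded_on f \<sigma> q \<Theta>"
    and "time_interval T"
    and "\<forall>t\<in>T. \<theta> t \<in> \<Theta>"
  shows "(solves_projected_fpk f \<sigma> q T \<theta>\<^sub>0 \<theta> \<longleftrightarrow>
            solves_galerkin f \<sigma> (mixture_basis q) (range Some) T
              (mixture_coeffs \<theta>\<^sub>0) (\<lambda>t. mixture_coeffs (\<theta> t)))
       \<and> (solves_galerkin f \<sigma> (mixture_basis q) UNIV T
              (mixture_coeffs \<theta>\<^sub>0) (\<lambda>t. mixture_coeffs (\<theta> t)) \<longleftrightarrow>
            solves_projected_fpk f \<sigma> q T \<theta>\<^sub>0 \<theta> \<and>
            solves_galerkin f \<sigma> (mixture_basis q) {None} T
              (mixture_coeffs \<theta>\<^sub>0) (\<lambda>t. mixture_coeffs (\<theta> t)))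
       \<and> (\<forall>t\<in>T. galerkin_approximation (mixture_basis q) (mixture_coeffs (\<theta> t)) = mixture q (\<theta> t))"
proof -
  have "solves_projected_fpk f \<sigma> q T \<theta>\<^sub>0 \<theta> \<longleftrightarrow>
      solves_galerkin f \<sigma> (mixture_basis q) (range Some) T
        (mixture_coeffs \<theta>\<^sub>0) (\<lambda>t. mixture_coeffs (\<theta> t))"
    using assms(1,3)
    by (intro solves_projected_iff_galerkin_tangent) (auto simp: simple_mixture_family_def)
  moreover have "solves_galerkin f \<sigma> (mixture_basis q) UNIV T c\<^sub>0 c \<longleftrightarrow>
      solves_galerkin f \<sigma> (mixture_basis q) (range Some) T c\<^sub>0 c \<and>
      solves_galerkin f \<sigma> (mixture_basis q) {None} T c\<^sub>0 c" for c\<^sub>0 c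
    using solves_galerkin_Un[OF assms(3), where J = "range Some" and K = "{None}"]
    by (simp add: UNIV_option_conv)
  ultimately show ?thesis
    by (simp add: galerkin_approximation_mixture)
qed

end
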